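(* Let $1\le p<\infty$. If the inclusion $\ell_p\subset\ell_p^{\lambda}(\widehat F)$ holds, then $(1/\lambda_n)_{n\in\mathbb N_0}\in\ell_p$.
   Context: $\mathbb N_0=\{0,1,2,\dots\}$; $\omega$ is the space of all real sequences $x=(x_k)_{k\in\mathbb N_0}$. Fibonacci numbers: $f_0=f_1=1$, $f_n=f_{n-1}+f_{n-2}$ for $n\ge 2$. $\lambda=(\lambda_k)_{k\in\mathbb N_0}$ is a strictly increasing sequence of positive reals with $\lambda_k\to\infty$. Terms with negative subscript are $0$ (so $\lambda_{-1}=0$, $x_{-1}=0$). For $x\in\omega$ put $$E_n(x)=\frac1{\lambda_n}\sum_{k=0}^n(\lambda_k-\lambda_{k-1})\Big(\frac{f_k}{f_{k+1}}x_k-\frac{f_{k+1}}{f_k}x_{k-1}\Big),\qquad Ex=(E_n(x))_{n\in\mathbb N_0},$$ and $\ell_p^{\lambda}(\widehat F)=\{x\in\omega: Ex\in\ell_p\}$. *)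

theory Defs
  imports "HOL-Analysis.Analysis" "HOL-Number_Theory.Fib"
begin

(* The library's fib starts with fib 0 = 0 and fib 1 = 1; here the convention is
   f_0 = f_1 = 1, hence the index shift. *)
definition fibo :: "nat \<Rightarrow> real" where
  "fibo n = real (fib (Suc n))"

lemma fibo_0: "fibo 0 = 1" and fibo_1: "fibo 1 = 1"
  and fibo_rec: "n \<ge> 2 \<Longrightarrow> fibo n = fibo (n - 1) + fibo (n - 2)"
  by (auto simp: fibo_def numeral_2_eq_2 dest!: le_Suc_ex)

(* prev x k is x_{k-1}, where terms with negative subscript are 0. *)
definition prev :: "(nat \<Rightarrow> real) \<Rightarrow> nat \<Rightarrow> real" where
  "prev x k = (case k of 0 \<Rightarrow> 0 | Suc j \<Rightarrow> x j)"

definition ell :: "real \<Rightarrow> (nat \<Rightarrow> real) set" where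
  "ell p = {x. summable (\<lambda>k. \<bar>x k\<bar> powr p)}"

definition E_mean :: "(nat \<Rightarrow> real) \<Rightarrow> (nat \<Rightarrow> real) \<Rightarrow> nat \<Rightarrow> real" where
  "E_mean lam x n = 1 / lam n *
     (\<Sum>k=0..n. (lam k - prev lam k) * (fibo k / fibo (k + 1) * x k - fibo (k + 1) / fibo k * prev x k))"

definition ell_lambda_F :: "real \<Rightarrow> (nat \<Rightarrow> real) \<Rightarrow> (nat \<Rightarrow> real) set" where
  "ell_lambda_F p lam = {x. E_mean lam x \<in> ell p}"

end

theory Submission
  imports Defs
begin

text \<open>
  For \<open>n > j\<close> the unit sequence \<open>e\<^sub>j\<close> has \<open>E\<^sub>n(e\<^sub>j) = c\<^sub>j / \<lambda>\<^sub>n\<close> with a constant \<open>c\<^sub>j\<close>, so a single nonzero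
  \<open>c\<^sub>j\<close> suffices. If all \<open>c\<^sub>j\<close> vanished, the increments of \<open>\<lambda>\<close> would satisfy
  \<open>d\<^sub>j\<^sub>+\<^sub>1 = (f\<^sub>j / f\<^sub>j\<^sub>+\<^sub>2) d\<^sub>j \<le> d\<^sub>j / 2\<close>, and \<open>\<lambda>\<close> would be bounded.
\<close>

text \<open>This is c_j: its two parts come from the summands k = j and k = j + 1, the only ones in
  which the unit sequence is felt.\<close>

definition unit_coeff :: "(nat \<Rightarrow> real) \<Rightarrow> nat \<Rightarrow> real" where
  "unit_coeff lam j = (lam j - prev lam j) * (fibo j / fibo (j + 1))
     - (lam (Suc j) - lam j) * (fibo (j + 2) / fibo (j + 1))"

lemma fibo_pos: "0 < fibo n"
  by (simp add: fibo_def fib_neq_0_nat)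

text \<open>Monotonicity gives f_(n+1) \<ge> f_n in the recursion; this is the source of the factor
  1/2.\<close>

lemma fibo_double_le: "2 * fibo n \<le> fibo (n + 2)"
  using fib_mono[of "Suc n" "n + 2"] by (simp add: fibo_def)

lemma unit_in_ell: "(\<lambda>k. if k = j then 1 else 0) \<in> ell p"
  unfolding ell_def mem_Collect_eq by (rule summable_finite[of "{j}"]) auto

text \<open>The condition \<open>j < n\<close> keeps both indices j and j + 1 inside the range of
  summation.\<close>

lemma E_mean_unit:
  assumes "j < n"
  shows "E_mean lam (\<lambda>k. if k = j then 1 else 0) n = unit_coeff lam j / lam n"
proof -
  let ?x = "\<lambda>k. if k = j then 1 else 0 :: real"
  let ?t = "\<lambda>k. (lam k - prev lam k) *
    (fibo k / fibo (k + 1) * ?x k - fibo (k + 1) / fibo k * prev ?x k)"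
  have "(\<Sum>k=0..n. ?t k) = (\<Sum>k\<in>{j, Suc j}. ?t k)"
    using assms by (intro sum.mono_neutral_right) (auto simp: prev_def split: nat.splits)
  also have "\<dots> = unit_coeff lam j"
    by (simp add: unit_coeff_def prev_def split: nat.splits)
  finally show ?thesis by (simp add: E_mean_def)
qed

lemma bounded_if_unit_coeff_zero:
  assumes "strict_mono lam" and "0 \<le> lam 0" and zero: "\<And>j. unit_coeff lam j = 0"
  shows "lam j \<le> 2 * lam 0"
proof -
  \<comment> \<open>Adding the last increment d_j makes the bound inductive: \<lambda>_(j+1) +
    d_(j+1) = \<lambda>_j + 2 d_(j+1) \<le> \<lambda>_j + d_j. At j = 0 it is an equality, since d_0
    = \<lambda>_0. The second conjunct supplies the sign needed to multiply by the Fibonacci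
    inequality.\<close>
  have "lam j + (lam j - prev lam j) \<le> 2 * lam 0 \<and> 0 \<le> lam (Suc j) - lam j" for j
  proof (induction j)
    case 0
    then show ?case
      using strict_monoD[OF assms(1), of 0 "Suc 0"] by (simp add: prev_def)
  next
    case (Suc j)
    have "(lam j - prev lam j) * fibo j = (lam (Suc j) - lam j) * fibo (j + 2)"
      using zero[of j] fibo_pos[of "j + 1"] by (simp add: unit_coeff_def field_simps)
    moreover have "(lam (Suc j) - lam j) * (2 * fibo j) \<le> (lam (Suc j) - lam j) * fibo (j + 2)"
      using Suc fibo_double_le by (intro mult_left_mono) auto
    ultimately have "(2 * (lam (Suc j) - lam j)) * fibo j \<le> (lam j - prev lam j) * fibo j"
      by (simp add: mult_ac)
    then have "2 * (lam (Suc j) - lam j) \<le> lam j - prev lam j"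
      using fibo_pos[of j] by (simp only: mult_le_cancel_right_pos)
    then show ?case
      using Suc strict_monoD[OF assms(1), of "Suc j" "Suc (Suc j)"] by (simp add: prev_def)
  qed
  from this[of j] have "lam j + (lam j - prev lam j) \<le> 2 * lam 0" by blast
  moreover have "prev lam j \<le> lam j"
    using assms(2) strict_monoD[OF assms(1)] by (cases j) (auto simp: prev_def less_imp_le)
  ultimately show ?thesis by linarith
qed

theorem theorem2p9:
  fixes p :: real and lam :: "nat \<Rightarrow> real"
  assumes "strict_mono lam"
    and "\<And>k. 0 < lam k"
    and "filterlim lam at_top sequentially"
    and "1 \<le> p"
    and "ell p \<subseteq> ell_lambda_F p lam"
  shows "(\<lambda>n. 1 / lam n) \<in> ell p"
proof -
  have "\<exists>n. 2 * lam 0 < lam n"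
    using assms(3) by (auto simp: filterlim_at_top_dense eventually_sequentially)
  then obtain j where c: "unit_coeff lam j \<noteq> 0"
    using bounded_if_unit_coeff_zero[OF assms(1)] assms(2)[of 0] by (metis less_imp_le not_le)
  let ?c = "unit_coeff lam j"
  have "summable (\<lambda>n. \<bar>E_mean lam (\<lambda>k. if k = j then 1 else 0) n\<bar> powr p)"
    using subsetD[OF assms(5) unit_in_ell[of j p]] by (simp add: ell_lambda_F_def ell_def)
  \<comment> \<open>The formula holds only beyond j, but finitely many terms do not affect
    summability. As c_j is nonzero, the constant factor can then be cancelled.\<close>
  moreover have "\<forall>\<^sub>F n in sequentially.
      \<bar>E_mean lam (\<lambda>k. if k = j then 1 else 0) n\<bar> powr p = \<bar>?c\<bar> powr p * \<bar>1 / lam n\<bar> powr p"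
    using eventually_gt_at_top[of j]
    by eventually_elim (simp add: E_mean_unit flip: powr_mult abs_mult)
  ultimately have "summable (\<lambda>n. \<bar>?c\<bar> powr p * \<bar>1 / lam n\<bar> powr p)"
    by (rule iffD1[OF summable_cong, rotated])
  then show ?thesis
    using c by (simp add: ell_def summable_cmult_iff)
qed

end
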